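(* Let $n\ge 2$ and let $K\subset\mathbb{R}^n$ be a compact set having at least two elements and satisfying the following condition: for all $x,y\in\partial K$ and all $\sigma\in\mathbb{S}^{n-1}$, $$\text{either}\quad \frac{x+y}{2}+\frac{|x-y|}{2}\sigma\in K\quad\text{or}\quad \frac{x+y}{2}-\frac{|x-y|}{2}\sigma\in K.$$ Then $K$ is an $n$-dimensional Euclidean ball, i.e. $K=\{y\in\mathbb{R}^n: |y-x_0|\le R\}$ for some $x_0\in\mathbb{R}^n$ and some $R>0$.
   Context: $\mathbb{R}^n$ carries the Euclidean norm $|\cdot|$; $\partial K$ is the topological boundary of $K$ in $\mathbb{R}^n$; $\mathbb{S}^{n-1}=\{\sigma\in\mathbb{R}^n:|\sigma|=1\}$. "Either ... or" is inclusive (at least one of the two points is in $K$). *)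

theory Defs
  imports "HOL-Analysis.Analysis"
begin

end

theory Submission
  imports Defs
begin

text \<open>
  A section of \<open>K\<close> by a plane inherits the hypothesis, so the heart of the matter is the planar case. Once
  plane sections are known to be discs, the planes through two points of \<open>K\<close> at maximal distance all
  cut out discs with the same centre and radius (\<open>antipodal_property_imp_ball\<close>).
  
  Let \<open>K\<close> be a plane set. For support points \<open>x\<close> and \<open>y\<close> in opposite directions \<open>\<plusminus> u\<close>, one of the two points of
  the circle over \<open>x\<close> and \<open>y\<close> in the directions \<open>\<plusminus> u\<close> is in \<open>K\<close>, hence in the supporting strip. This forces
  \<open>x - y\<close> to be parallel to \<open>u\<close> (\<open>support_point_diff\<close>). It follows that the width is a constant
  \<open>2 * r\<close> (\<open>width_constant\<close>). So the support points are \<open>m t \<plusminus> r cis t\<close>, where \<open>m t\<close> is the midpoint of the diametral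
  chord in direction \<open>cis t\<close>, and \<open>m\<close> is a continuous curve with period \<open>pi\<close>. The set \<open>K\<close> is a disc if \<open>m\<close> is constant.
  
  Constant width alone does not make \<open>m\<close> constant (think of the Reuleaux triangle). Therefore the hypothesis is
  used for the diametral chords again, now in all directions. The circle around \<open>m \<theta>\<close> with radius \<open>r\<close> has
  \<open>m \<theta> + r cis \<phi>\<close> or \<open>m \<theta> - r cis \<phi>\<close> in \<open>K\<close>. Comparison with the supporting strips in directions near \<open>\<phi>\<close> shows that the line
  \<open>L\<^sub>\<phi>\<close> through \<open>m \<phi>\<close> with normal \<open>cis \<phi>\<close>, to which the curve \<open>m\<close> is tangent, meets the curve in \<open>m \<phi>\<close>
  only (\<open>m_tangent\<close>). A closed curve that meets each of its turning tangent lines only once must be a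
  point (\<open>m_constant\<close>). The argument for this uses the order of points on the curve and intermediate
  values, because nothing beyond the continuity of \<open>m\<close> and the first variation of its heights is at hand.
  
  Finally the circle of radius \<open>r\<close> lies in \<open>K\<close>, and one more use of the hypothesis, for pairs of points on this
  circle, fills the disc (\<open>is_disc\<close>).
\<close>

section \<open>Auxiliary facts on the real line\<close>

lemma compact_zeros_Icc:
  fixes f :: "real \<Rightarrow> real"
  assumes "continuous_on {a..b} f"
  shows "compact {t \<in> {a..b}. f t = 0}"
proof -
  have "closed {t \<in> {a..b}. f t = 0}"
    by (rule continuous_closed_preimage_constant[OF assms]) simp
  moreover have "bounded {t \<in> {a..b}. f t = 0}"
    by (rule bounded_subset[OF bounded_closed_interval[of a b]]) auto
  ultimately show ?thesis by (simp add: compact_eq_bounded_closed)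
qed

text \<open>
  A function leaving a zero upwards stays positive until its next zero, where it cannot arrive with
  positive slope.
\<close>

lemma next_zero_with_nonpos_slope:
  fixes G G' :: "real \<Rightarrow> real"
  assumes d: "\<And>t. (G has_real_derivative G' t) (at t)"
    and "\<alpha> < \<beta>" "G \<alpha> = 0" "G \<beta> = 0" "G' \<alpha> > 0"
  shows "\<exists>z. \<alpha> < z \<and> z \<le> \<beta> \<and> G z = 0 \<and> G' z \<le> 0"
proof -
  obtain \<delta> where \<delta>: "\<delta> > 0" "\<And>h. 0 < h \<Longrightarrow> h < \<delta> \<Longrightarrow> G \<alpha> < G (\<alpha> + h)"
    using DERIV_pos_inc_right[OF d \<open>G' \<alpha> > 0\<close>] by blast
  define s where "s = \<alpha> + min \<delta> (\<beta> - \<alpha>) / 2"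
  have s: "\<alpha> < s" "s < \<beta>" using \<delta>(1) assms(2) by (auto simp: s_def min_def field_simps)
  have "0 < min \<delta> (\<beta> - \<alpha>) / 2" "min \<delta> (\<beta> - \<alpha>) / 2 < \<delta>"
    using \<delta>(1) assms(2) by (auto simp: min_def)
  then have Gs: "G s > 0" using \<delta>(2) assms(3) unfolding s_def by metis
  have cont: "continuous_on S G" for S
    by (meson DERIV_isCont d continuous_at_imp_continuous_on)
  define Z where "Z = {t \<in> {s..\<beta>}. G t = 0}"
  have "compact Z" unfolding Z_def by (rule compact_zeros_Icc[OF cont])
  moreover have "\<beta> \<in> Z" using s assms by (auto simp: Z_def)
  ultimately obtain z where z: "z \<in> Z" "\<And>t. t \<in> Z \<Longrightarrow> z \<le> t"
    using compact_attains_inf[of Z] by (metis empty_iff)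
  have "s < z" using z(1) Gs by (auto simp: Z_def less_le)
  have pos: "G t > 0" if "s \<le> t" "t < z" for t
  proof (rule ccontr)
    assume "\<not> G t > 0"
    with that(1) obtain u where "s \<le> u" "u \<le> t" "G u = 0"
      using IVT2'[of G t 0 s] Gs cont[of "{s..t}"] by auto
    then show False using z that by (force simp: Z_def)
  qed
  have "G' z \<le> 0"
  proof (rule ccontr)
    assume "\<not> G' z \<le> 0"
    then obtain \<epsilon> where \<epsilon>: "\<epsilon> > 0" "\<And>h. 0 < h \<Longrightarrow> h < \<epsilon> \<Longrightarrow> G (z - h) < G z"
      using DERIV_pos_inc_left[OF d] by (metis not_le)
    define h where "h = min \<epsilon> (z - s) / 2"
    have "0 < h" "h < \<epsilon>" "s \<le> z - h"
      using \<epsilon>(1) \<open>s < z\<close> by (auto simp: h_def min_def field_simps)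
    then show False using pos[of "z - h"] \<epsilon>(2)[of h] z(1) by (auto simp: Z_def)
  qed
  then show ?thesis using z(1) s by (intro exI[of _ z]) (auto simp: Z_def)
qed

text \<open>
  A walk on the line from a point of \<open>A\<close> to a point of \<open>B\<close> has a last visit to \<open>A\<close> before its first
  visit to \<open>B\<close>; the points in between belong to neither set.
\<close>

lemma gap_between_closed:
  fixes A B :: "real set"
  assumes "closed A" "closed B" "A \<inter> B = {}" "s \<in> A" "t \<in> B" "s < t"
  shows "\<exists>a b. s \<le> a \<and> a < b \<and> b \<le> t \<and> a \<in> A \<and> b \<in> B \<and> {a<..<b} \<inter> (A \<union> B) = {}"
proof -
  have "compact ({s..t} \<inter> B)" using assms(2) by (simp add: compact_Int_closed)
  moreover have "t \<in> {s..t} \<inter> B" using assms by simp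
  ultimately obtain b where b: "b \<in> {s..t} \<inter> B" "\<And>u. u \<in> {s..t} \<inter> B \<Longrightarrow> b \<le> u"
    using compact_attains_inf by (metis empty_iff)
  have "compact ({s..b} \<inter> A)" using assms(1) by (simp add: compact_Int_closed)
  moreover have "s \<in> {s..b} \<inter> A" using assms b by simp
  ultimately obtain a where a: "a \<in> {s..b} \<inter> A" "\<And>u. u \<in> {s..b} \<inter> A \<Longrightarrow> u \<le> a"
    using compact_attains_sup by (metis empty_iff)
  have "a \<noteq> b" using a b assms(3) by auto
  moreover have "{a<..<b} \<inter> (A \<union> B) = {}"
  proof -
    have "u \<notin> A \<union> B" if "a < u" "u < b" for u
      using a(1) a(2)[of u] b(1) b(2)[of u] that by auto
    then show ?thesis by auto
  qed
  ultimately show ?thesis using a b by (intro exI[of _ a] exI[of _ b]) auto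
qed

section \<open>The rotating orthonormal frame\<close>

lemma cis_inner_cis: "cis s \<bullet> cis t = cos (s - t)"
  by (simp add: inner_complex_def cos_diff)

lemma icis_inner_cis: "(\<i> * cis s) \<bullet> cis t = sin (t - s)"
  by (simp add: inner_complex_def sin_diff algebra_simps)

lemma cmod_power2_cis: "(cmod z)\<^sup>2 = (z \<bullet> cis t)\<^sup>2 + (z \<bullet> (\<i> * cis t))\<^sup>2"
proof -
  have "(z \<bullet> cis t)\<^sup>2 + (z \<bullet> (\<i> * cis t))\<^sup>2 = ((Re z)\<^sup>2 + (Im z)\<^sup>2) * ((cos t)\<^sup>2 + (sin t)\<^sup>2)"
    unfolding inner_complex_def by (simp only: times_complex.sel imaginary_unit.sel cis.sel) algebra
  then show ?thesis by (simp add: cmod_power2)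
qed

lemma complex_eq_0_iff_inner_cis: "z = 0 \<longleftrightarrow> z \<bullet> cis t = 0 \<and> z \<bullet> (\<i> * cis t) = 0"
  using cmod_power2_cis[of z t] by (auto simp: sum_power2_eq_zero_iff)

section \<open>Closed curves that meet each of their tangent lines once\<close>

text \<open>
  The line \<open>L\<^sub>t\<close> through \<open>m t\<close> with normal \<open>cis t\<close> turns at unit speed, and \<open>m\<close> is the envelope of these lines:
  for a differentiable \<open>m\<close> the assumption \<open>deriv\<close> says precisely that \<open>m'(t)\<close> is orthogonal to \<open>cis t\<close>. It is
  phrased through the heights \<open>(m t - c) \<bullet> cis t\<close> because \<open>m\<close> is only continuous. By \<open>periodic\<close>, \<open>L\<^sub>t\<close>
  is the same line after a half turn, with the opposite normal. The assumption \<open>tangent\<close> says that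
  \<open>L\<^sub>\<phi>\<close> meets the whole curve in the point \<open>m \<phi>\<close> alone. 
  
  Such a curve is a single point (\<open>m_constant\<close>). The reason is that it has to rest as long as it has points
  on both sides of its tangent line: along a smooth piece with \<open>m' \<noteq> 0\<close> the curve is a convex arc, so that
  \<open>m \<theta>\<close> and \<open>m \<phi>\<close> are on the same side of the tangent lines at each other's parameters, whereas
  \<open>tangent\<close> and the connectedness of the curve force opposite sides. And if the curve is all on one side of its
  tangent line, then \<open>m t\<close> is an extreme point in the direction \<open>\<plusminus> cis t\<close>, and convexity takes over.
\<close>

locale turning_curve =
  fixes m :: "real \<Rightarrow> complex"
  assumes continuous_m: "continuous_on UNIV m"
    and periodic: "m (t + pi) = m t"
    and deriv: "((\<lambda>t. (m t - c) \<bullet> cis t) has_real_derivative (m t - c) \<bullet> (\<i> * cis t)) (at t)"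
    and tangent: "(m \<phi> - m \<theta>) \<bullet> cis \<phi> = 0 \<Longrightarrow> m \<phi> = m \<theta>"
begin

text \<open>
  The signed distance by which the line \<open>L\<^sub>\<phi>\<close> lies above the point \<open>m \<theta>\<close>, in the direction \<open>cis \<phi>\<close>.
  The point \<open>m \<theta>\<close> is above \<open>L\<^sub>\<phi>\<close> if this is negative, and below it if it is positive.
\<close>

definition height :: "real \<Rightarrow> real \<Rightarrow> real" where "height \<theta> \<phi> = (m \<phi> - m \<theta>) \<bullet> cis \<phi>"

lemma height_eq_0_iff: "height \<theta> \<phi> = 0 \<longleftrightarrow> m \<phi> = m \<theta>"
  using tangent by (auto simp: height_def)

lemma height_cong: "m \<theta> = m \<theta>' \<Longrightarrow> height \<theta> \<phi> = height \<theta>' \<phi>"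
  by (simp add: height_def)

lemma height_pi: "height \<theta> (\<phi> + pi) = - height \<theta> \<phi>" "height (\<theta> + pi) \<phi> = height \<theta> \<phi>"
proof -
  have "cis (\<phi> + pi) = - cis \<phi>" by (simp add: complex_eq_iff)
  then show "height \<theta> (\<phi> + pi) = - height \<theta> \<phi>" by (simp only: height_def periodic inner_minus_right)
qed (simp add: height_def periodic)

lemma continuous_height: "continuous_on S (height \<theta>)" "continuous_on S (\<lambda>\<theta>. height \<theta> \<phi>)"
proof -
  have [continuous_intros]: "continuous_on S m" using continuous_m continuous_on_subset by blast
  show "continuous_on S (height \<theta>)" "continuous_on S (\<lambda>\<theta>. height \<theta> \<phi>)"
    unfolding height_def by (intro continuous_intros)+
qed

lemma periodic_nat: "m (t + real n * pi) = m t"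
proof (induction n)
  case (Suc n)
  then show ?case using periodic[of "t + real n * pi"] by (simp add: algebra_simps)
qed simp

text \<open>
  If \<open>m \<eta>\<close> is above both lines, then \<open>L\<^sub>\<theta>\<close> and \<open>L\<^sub>\<phi>\<close> cannot each be above the other one's contact point.
  Indeed, run along the curve from the last visit to \<open>m \<phi>\<close> up to \<open>m \<eta>\<close>. This piece stays above \<open>L\<^sub>\<phi>\<close>, since it
  could recross \<open>L\<^sub>\<phi>\<close> only in \<open>m \<phi>\<close>. But it starts below \<open>L\<^sub>\<theta>\<close> and ends above it, so it passes through
  \<open>m \<theta>\<close>, which is below \<open>L\<^sub>\<phi>\<close>.
\<close>

lemma not_mutually_above:
  assumes "height \<eta> \<phi> < 0" "height \<eta> \<theta> < 0" "height \<theta> \<phi> > 0" "height \<phi> \<theta> > 0"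
  shows False
proof -
  \<comment> \<open>By periodicity the parameter of the point above both lines may be taken beyond \<open>\<phi>\<close>.\<close>
  obtain n :: nat where "(\<phi> - \<eta>) / pi \<le> real n" using real_arch_simple by blast
  then have "\<phi> \<le> \<eta> + real n * pi" by (simp add: field_simps)
  then obtain \<eta>' where \<eta>': "\<phi> \<le> \<eta>'" "m \<eta>' = m \<eta>" using periodic_nat by blast
  have neg: "height \<eta>' \<phi> < 0" "height \<eta>' \<theta> < 0" using assms height_cong[OF \<eta>'(2)] by auto
  define Z where "Z = {t \<in> {\<phi>..\<eta>'}. height t \<phi> = 0}"
  have "compact Z" unfolding Z_def by (rule compact_zeros_Icc[OF continuous_height(2)])
  moreover have "\<phi> \<in> Z" using \<eta>' by (auto simp: Z_def height_def)
  ultimately obtain z where z: "z \<in> Z" "\<And>t. t \<in> Z \<Longrightarrow> t \<le> z"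
    using compact_attains_sup[of Z] by (metis empty_iff)
  have mz: "m z = m \<phi>" "z \<le> \<eta>'" "\<phi> \<le> z" using z(1) by (auto simp: Z_def height_eq_0_iff)
  have "height z \<theta> > 0" using assms(4) height_cong[OF mz(1)] by simp
  then obtain u where u: "z \<le> u" "u \<le> \<eta>'" "height u \<theta> = 0"
    using IVT2'[of "\<lambda>t. height t \<theta>" \<eta>' 0 z, OF _ _ _ continuous_height(2)] neg mz by auto
  then have "m u = m \<theta>" by (simp add: height_eq_0_iff)
  then have "height u \<phi> > 0" using assms(3) height_cong[of u \<theta> \<phi>] by simp
  then obtain w where w: "u \<le> w" "w \<le> \<eta>'" "height w \<phi> = 0"
    using IVT2'[of "\<lambda>t. height t \<phi>" \<eta>' 0 u, OF _ _ _ continuous_height(2)] neg u by auto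
  then have "w \<le> z" using z(2) u mz by (auto simp: Z_def)
  then have "u = z" using w u by auto
  then show False using z \<open>height u \<phi> > 0\<close> by (auto simp: Z_def)
qed

lemma not_mutually_below:
  assumes "height \<eta> \<phi> > 0" "height \<eta> \<theta> > 0" "height \<theta> \<phi> < 0" "height \<phi> \<theta> < 0"
  shows False
  using not_mutually_above[of \<eta> "\<phi> + pi" "\<theta> + pi"] assms by (simp add: height_pi)

text \<open>
  The points \<open>m p\<close> and \<open>m q\<close> lie on fixed opposite sides of \<open>L\<^sub>t\<close> for all \<open>t\<close> in the interval. Let \<open>c\<close> be the
  intersection of \<open>L\<^sub>\<alpha>\<close> and \<open>L\<^sub>\<beta>\<close>, and \<open>G t\<close> the height of \<open>L\<^sub>t\<close> over \<open>c\<close>. The zeros of \<open>G\<close> are the lines through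
  \<open>c\<close>, and the slope of \<open>G\<close> there is the position of the contact point on its line as seen from \<open>c\<close>. Hence
  \<open>not_mutually_above\<close> and \<open>not_mutually_below\<close> say that the slopes at any two zeros have the same sign.
  Consecutive simple zeros of a function have slopes of opposite signs, so all these slopes vanish,
  and both contact points coincide with \<open>c\<close>.
\<close>

lemma equal_ends:
  assumes ab: "\<alpha> < \<beta>" "\<beta> < \<alpha> + pi"
    and p: "\<And>t. t \<in> {\<alpha>..\<beta>} \<Longrightarrow> height p t < 0"
    and q: "\<And>t. t \<in> {\<alpha>..\<beta>} \<Longrightarrow> height q t > 0"
  shows "m \<alpha> = m \<beta>"
proof -
  have s: "sin (\<beta> - \<alpha>) > 0" using ab by (intro sin_gt_zero) auto
  \<comment> \<open>The intersection of the two lines, written as a point of \<open>L\<^sub>\<alpha>\<close>.\<close>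
  define c where "c = m \<alpha> - (((m \<alpha> - m \<beta>) \<bullet> cis \<beta>) / sin (\<beta> - \<alpha>)) *\<^sub>R (\<i> * cis \<alpha>)"
  define G where "G t = (m t - c) \<bullet> cis t" for t
  define G' where "G' t = (m t - c) \<bullet> (\<i> * cis t)" for t
  have d: "(G has_real_derivative G' t) (at t)" for t
    unfolding G_def G'_def by (rule deriv)
  have Ga: "G \<alpha> = 0" by (simp add: G_def c_def icis_inner_cis)
  have "(m \<alpha> - c) \<bullet> cis \<beta> = (m \<alpha> - m \<beta>) \<bullet> cis \<beta>"
    using s by (simp add: c_def icis_inner_cis)
  then have Gb: "G \<beta> = 0" by (simp add: G_def inner_diff_left)
  have rep: "m t - c = G' t *\<^sub>R (\<i> * cis t)" if "G t = 0" for t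
  proof -
    have "(\<i> * cis t) \<bullet> (\<i> * cis t) = 1"
      by (simp add: inner_complex_def flip: power2_eq_square)
    then show ?thesis
      using that complex_eq_0_iff_inner_cis[of "m t - c - G' t *\<^sub>R (\<i> * cis t)" t]
      by (simp add: G_def G'_def inner_diff_left icis_inner_cis)
  qed
  have e1: "height u v = G' u * sin (u - v)" if "G u = 0" "G v = 0" for u v
  proof -
    have "height u v = G v - (m u - c) \<bullet> cis v" by (simp add: height_def G_def inner_diff_left)
    then show ?thesis using that rep[OF that(1)] by (simp add: icis_inner_cis sin_diff algebra_simps)
  qed
  have slopes: "(G' u > 0 \<longleftrightarrow> G' v > 0) \<and> (G' u < 0 \<longleftrightarrow> G' v < 0)"
    if "G u = 0" "G v = 0" "\<alpha> \<le> u" "u < v" "v \<le> \<beta>" for u v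
  proof -
    have "sin (v - u) > 0" using that ab by (intro sin_gt_zero) auto
    moreover have "height u v = - (G' u * sin (v - u))" "height v u = G' v * sin (v - u)"
      using e1[OF that(1,2)] e1[OF that(2,1)] sin_minus[of "v - u"] by auto
    ultimately have sg: "height u v > 0 \<longleftrightarrow> G' u < 0" "height u v < 0 \<longleftrightarrow> G' u > 0"
      "height v u > 0 \<longleftrightarrow> G' v > 0" "height v u < 0 \<longleftrightarrow> G' v < 0"
      by (auto simp: zero_less_mult_iff mult_less_0_iff)
    have "height u v = 0 \<longleftrightarrow> height v u = 0" by (auto simp: height_eq_0_iff)
    moreover have "\<not> (height u v > 0 \<and> height v u > 0)" 
      using not_mutually_above[of p v u] p[of u] p[of v] that by auto
    moreover have "\<not> (height u v < 0 \<and> height v u < 0)" 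
      using not_mutually_below[of q v u] q[of u] q[of v] that by auto
    ultimately show ?thesis using sg by linarith
  qed
  have "\<not> G' \<alpha> > 0"
    using next_zero_with_nonpos_slope[OF d ab(1) Ga Gb] slopes[OF Ga] by force
  moreover have "\<not> G' \<alpha> < 0"
  proof
    assume "G' \<alpha> < 0"
    then obtain z where "\<alpha> < z" "z \<le> \<beta>" "G z = 0" "G' z \<ge> 0"
      using next_zero_with_nonpos_slope[of "\<lambda>t. - G t" "\<lambda>t. - G' t", OF DERIV_minus[OF d] ab(1)] Ga Gb by auto
    then show False using slopes[OF Ga, of z] \<open>G' \<alpha> < 0\<close> by auto
  qed
  ultimately have "G' \<alpha> = 0" by simp
  then have "G' \<beta> = 0" using slopes[OF Ga Gb] ab by force
  then show ?thesis using \<open>G' \<alpha> = 0\<close> rep[OF Ga] rep[OF Gb] by simp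
qed

text \<open>
  The parameters at which the whole curve lies on one side of its tangent line: below it for
  \<open>tops\<close>, above it for \<open>bottoms\<close>. A half turn exchanges the two sets.
\<close>

definition tops where "tops = {\<phi>. \<forall>p. height p \<phi> \<ge> 0}"
definition bottoms where "bottoms = {\<phi>. \<forall>p. height p \<phi> \<le> 0}"

lemma closed_tops: "closed tops" and closed_bottoms: "closed bottoms"
  unfolding tops_def bottoms_def
  by (auto intro!: closed_Collect_all closed_Collect_le continuous_height)

lemma tops_pi: "\<phi> + pi \<in> tops \<longleftrightarrow> \<phi> \<in> bottoms" "\<phi> + pi \<in> bottoms \<longleftrightarrow> \<phi> \<in> tops"
  by (auto simp: tops_def bottoms_def height_pi)

text \<open>
  Away from \<open>tops\<close> and \<open>bottoms\<close> there are points strictly on both sides of \<open>L\<^sub>\<phi>\<close>, and the same two points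
  serve all nearby lines, so \<open>equal_ends\<close> makes the curve locally constant there.
\<close>

lemma constant_on_gap:
  assumes "a < b" "{a<..<b} \<inter> (tops \<union> bottoms) = {}" "s \<in> {a..b}" "t \<in> {a..b}"
  shows "m s = m t"
proof -
  have loc: "\<exists>d>0. \<forall>u. \<bar>u - \<phi>\<bar> < d \<longrightarrow> m u = m \<phi>" if "\<phi> \<in> {a<..<b}" for \<phi>
  proof -
    from that assms(2) have "\<phi> \<notin> tops" "\<phi> \<notin> bottoms" by auto
    then obtain p q where pq: "height p \<phi> < 0" "height q \<phi> > 0"
      by (auto simp: tops_def bottoms_def not_le)
    have "open {t. height p t < 0 \<and> height q t > 0}"
      by (intro open_Collect_conj open_Collect_less continuous_height continuous_on_const)
    then obtain d where d: "d > 0" "\<And>t. dist t \<phi> < d \<Longrightarrow> height p t < 0 \<and> height q t > 0"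
      using pq unfolding open_dist by blast
    have "m u = m \<phi>" if "\<bar>u - \<phi>\<bar> < min d pi" for u
    proof -
      consider "u = \<phi>" | "u < \<phi>" | "\<phi> < u" by linarith
      then show ?thesis
      proof cases
        case 2
        then show ?thesis using equal_ends[of u \<phi> p q] d(2) that
          by (simp add: dist_real_def)
      next
        case 3
        then show ?thesis using equal_ends[of \<phi> u p q] d(2) that
          by (simp add: dist_real_def)
      qed simp
    qed
    then show ?thesis using d(1) by (metis min_less_iff_conj pi_gt_zero)
  qed
  define c where "c = m ((a + b) / 2)"
  have "(m has_derivative (\<lambda>h. 0)) (at \<phi>)" if \<phi>: "\<phi> \<in> {a<..<b}" for \<phi>
  proof -
    obtain d where d: "d > 0" "\<And>u. \<bar>u - \<phi>\<bar> < d \<Longrightarrow> m u = m \<phi>" using loc[OF \<phi>] by blast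
    have "m \<phi> = m u" if "dist u \<phi> < d" for u
      using d(2)[of u] that by (simp add: dist_real_def)
    then show ?thesis
      by (rule has_derivative_transform_within[OF has_derivative_const d(1) UNIV_I])
  qed
  then have open_const: "m u = c" if "u \<in> {a<..<b}" for u
    using has_derivative_zero_unique[of "{a<..<b}" m u "(a + b) / 2"] that assms(1)
    by (auto simp: c_def intro: has_derivative_at_withinI)
  have "closure {a<..<b} \<subseteq> {u. m u = c}"
  proof (rule closure_minimal)
    show "closed {u. m u = c}" 
      by (intro closed_Collect_eq continuous_m continuous_on_const)
  qed (use open_const in auto)
  then have "{a..b} \<subseteq> {u. m u = c}"
    using assms(1) by (simp add: closure_greaterThanLessThan)
  then have "m s = c" "m t = c" using assms(3,4) by auto
  then show ?thesis by simp
qed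

text \<open>
  Suppose that the curve is not a point, so that \<open>tops\<close> and \<open>bottoms\<close> are disjoint. The curve rests in a
  point \<open>c\<close> on some interval \<open>[a, b]\<close> leading from \<open>tops\<close> to \<open>bottoms\<close>. So \<open>c\<close> is lowest in the curve in the
  direction \<open>cis b\<close> and also in the direction \<open>cis (a + pi) = - cis a\<close>, hence in all directions between these.
  This pins the curve to \<open>c\<close> on \<open>[b, a + pi]\<close> too: it rests in \<open>c\<close> at each parameter of \<open>bottoms\<close>, it cannot leave
  \<open>c\<close> while it avoids \<open>tops\<close> and \<open>bottoms\<close>, and it cannot return to \<open>tops\<close> at \<open>c\<close>, which would then be both
  highest and lowest in the same direction. So it stays at \<open>c\<close> for a full period.
\<close>

theorem m_constant: "m s = m t"
proof (rule ccontr)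
  assume nonconst: "m s \<noteq> m t"
  have disj: "tops \<inter> bottoms = {}"
  proof -
    have "False" if "\<phi> \<in> tops" "\<phi> \<in> bottoms" for \<phi>
    proof -
      have "height p \<phi> = 0" for p using that by (auto simp: tops_def bottoms_def intro: antisym)
      then have "m \<phi> = m p" for p by (simp add: height_eq_0_iff)
      then show False using nonconst by metis
    qed
    then show ?thesis by blast
  qed
  obtain a0 where a0: "a0 \<in> tops"
  proof (cases "tops = {}")
    case True
    then have "bottoms = {}" using tops_pi(1) by blast
    then have "m s = m t"
      using constant_on_gap[of "min s t - 1" "max s t" s t] True by auto
    then show ?thesis using nonconst by blast
  qed blast
  obtain a b where ab: "a < b" "b \<le> a + pi" "a \<in> tops" "b \<in> bottoms"
    "{a<..<b} \<inter> (tops \<union> bottoms) = {}"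
    using gap_between_closed[OF closed_tops closed_bottoms disj a0, of "a0 + pi"] a0 tops_pi
    by force
  define c where "c = m a"
  have c1: "m u = c" if "u \<in> {a..b}" for u
    using constant_on_gap[OF ab(1,5) that, of a] ab(1) by (simp add: c_def)
  have low: "(m p - c) \<bullet> cis \<phi> \<ge> 0" if \<phi>: "\<phi> \<in> {b..a+pi}" for p \<phi>
  proof (cases "b = a + pi")
    case True
    then show ?thesis using ab(4) \<phi> c1[of b] ab(1) 
      by (auto simp: bottoms_def height_def inner_diff_left)
  next
    case False
    then have s: "sin (a + pi - b) > 0" using ab by (intro sin_gt_zero) auto
    \<comment> \<open>The direction \<open>cis \<phi>\<close> is a nonnegative combination of the two extreme directions.\<close>
    have "sin (a + pi - b) *\<^sub>R cis \<phi> = sin (a + pi - \<phi>) *\<^sub>R cis b + sin (\<phi> - b) *\<^sub>R cis (a + pi)"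
    proof -
      have *: "sin (y - x) * cos z = sin (y - z) * cos x + sin (z - x) * cos y"
           "sin (y - x) * sin z = sin (y - z) * sin x + sin (z - x) * sin y" for x y z :: real
        unfolding sin_diff by algebra+
      show ?thesis using *[of "a + pi" b \<phi>] by (simp only: complex_eq_iff plus_complex.sel scaleR_complex.sel cis.sel)
    qed
    moreover have "(m p - c) \<bullet> cis b \<ge> 0" "(m p - c) \<bullet> cis (a + pi) \<ge> 0"
    proof -
      show "(m p - c) \<bullet> cis b \<ge> 0"
        using ab(4) c1[of b] ab(1) by (auto simp: bottoms_def height_def inner_diff_left)
      have "a + pi \<in> bottoms" using ab(3) tops_pi by simp
      then have "height p (a + pi) \<le> 0" by (simp add: bottoms_def)
      then show "(m p - c) \<bullet> cis (a + pi) \<ge> 0"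
        by (simp only: height_def c_def periodic inner_diff_left)
    qed
    moreover have "sin (a + pi - \<phi>) \<ge> 0" "sin (\<phi> - b) \<ge> 0"
      using \<phi> ab by (auto intro!: sin_ge_zero)
    ultimately have "sin (a + pi - b) * ((m p - c) \<bullet> cis \<phi>) \<ge> 0"
      by (metis add_nonneg_nonneg inner_add_right inner_scaleR_right mult_nonneg_nonneg)
    then show ?thesis using s by (simp add: zero_le_mult_iff)
  qed
  have low_bot: "m \<phi> = c" if "\<phi> \<in> {b..a+pi}" "\<phi> \<in> bottoms" for \<phi>
  proof -
    have "height a \<phi> \<le> 0" using that by (simp add: bottoms_def)
    moreover have "height a \<phi> \<ge> 0" using low[OF that(1)] by (simp add: height_def c_def)
    ultimately show ?thesis using height_eq_0_iff c_def by force
  qed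
  have c2: "m \<phi> = c" if \<phi>: "\<phi> \<in> {b..a+pi}" for \<phi>
  proof (rule ccontr)
    assume ne: "m \<phi> \<noteq> c"
    then have "\<phi> \<notin> bottoms" using low_bot \<phi> by blast
    \<comment> \<open>Adding \<open>\<phi>\<close> to \<open>tops\<close> treats leaving \<open>c\<close> and returning to \<open>tops\<close> at once.\<close>
    then have "bottoms \<inter> insert \<phi> tops = {}" "b < \<phi>"
      using disj \<phi> ab(4) by (auto simp: less_le)
    then obtain a2 b2 where g: "b \<le> a2" "a2 < b2" "b2 \<le> \<phi>" "a2 \<in> bottoms" "b2 \<in> insert \<phi> tops"
      "{a2<..<b2} \<inter> (bottoms \<union> insert \<phi> tops) = {}"
      using gap_between_closed[OF closed_bottoms closed_insert[OF closed_tops, of \<phi>], of b \<phi>] ab(4)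
      by auto
    have "m b2 = m a2" using constant_on_gap[of a2 b2 b2 a2] g by auto
    then have mb: "m b2 = c" using low_bot[of a2] g \<phi> by auto
    then have "b2 \<in> tops" using g(5) ne by auto
    have "b2 \<in> bottoms"
      using low[of b2] g \<phi> mb by (auto simp: bottoms_def height_def inner_diff_left)
    then show False using \<open>b2 \<in> tops\<close> disj by blast
  qed
  have c3: "m u = c" if "u \<in> {a..a+pi}" for u
    using c1[of u] c2[of u] that by fastforce
  have "m u = c" for u
  proof -
    obtain n :: nat where "(a - u) / pi \<le> real n" using real_arch_simple by blast
    then have "a \<le> u + real n * pi" by (simp add: field_simps)
    define v where "v = u + real n * pi"
    define k where "k = nat \<lfloor>(v - a) / pi\<rfloor>"
    have "real k \<le> (v - a) / pi" "(v - a) / pi < real k + 1"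
      using \<open>a \<le> u + real n * pi\<close> by (auto simp: k_def v_def)
    then have "v - real k * pi \<in> {a..a+pi}" by (auto simp: field_simps)
    then show ?thesis using c3 periodic_nat[of "v - real k * pi" k] periodic_nat[of u n]
      by (simp add: v_def)
  qed
  then show False using nonconst by simp
qed

end

section \<open>Plane sets: support points and constant width\<close>

definition antipodal_property :: "'a::euclidean_space set \<Rightarrow> bool" where
  "antipodal_property K \<longleftrightarrow>
    (\<forall>x\<in>frontier K. \<forall>y\<in>frontier K. \<forall>\<sigma>\<in>sphere 0 1.
      (1 / 2) *\<^sub>R (x + y) + (norm (x - y) / 2) *\<^sub>R \<sigma> \<in> K \<or>
      (1 / 2) *\<^sub>R (x + y) - (norm (x - y) / 2) *\<^sub>R \<sigma> \<in> K)"

lemma maximizer_in_frontier: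
  fixes x u :: "'a::real_inner"
  assumes "x \<in> K" "\<And>z. z \<in> K \<Longrightarrow> z \<bullet> u \<le> x \<bullet> u" "u \<noteq> 0"
  shows "x \<in> frontier K"
proof -
  have "x \<notin> interior K"
  proof
    assume "x \<in> interior K"
    then obtain e where e: "e > 0" "cball x e \<subseteq> K"
      using mem_interior_cball by blast
    define z where "z = x + (e / norm u) *\<^sub>R u"
    have "z \<in> K" using e assms(3) by (auto simp: z_def dist_norm)
    then have "z \<bullet> u \<le> x \<bullet> u" by (rule assms(2))
    moreover have "z \<bullet> u = x \<bullet> u + e * norm u"
      using assms(3) by (simp add: z_def inner_add_left power2_norm_eq_inner[symmetric] power2_eq_square)
    ultimately show False using e(1) assms(3) by (simp add: mult_le_0_iff)
  qed
  then show ?thesis using assms(1) closure_subset by (auto simp: frontier_def)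
qed

lemma scaleR_unit_if_inner_ge:
  fixes v u :: "'a::real_inner"
  assumes "norm u = 1" "norm v \<le> v \<bullet> u"
  shows "v = norm v *\<^sub>R u"
proof -
  have "v \<bullet> u = norm v * norm u"
    using assms norm_cauchy_schwarz[of v u] by simp
  then show ?thesis using assms(1) norm_cauchy_schwarz_eq[of v u] by simp
qed

text \<open>
  Plane sets are taken in the complex numbers, so that directions are the values of \<open>cis\<close>.
\<close>

locale planar_body =
  fixes K :: "complex set"
  assumes compact_K: "compact K"
    and nontrivial: "\<exists>a\<in>K. \<exists>b\<in>K. a \<noteq> b"
    and antipodal: "antipodal_property K"
begin

definition support_point :: "complex \<Rightarrow> complex" where
  "support_point u = (SOME x. x \<in> K \<and> (\<forall>z\<in>K. z \<bullet> u \<le> x \<bullet> u))"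

lemma support_point_in: "support_point u \<in> K" and support_point_max: "z \<in> K \<Longrightarrow> z \<bullet> u \<le> support_point u \<bullet> u"
proof -
  have "\<exists>x\<in>K. \<forall>z\<in>K. z \<bullet> u \<le> x \<bullet> u"
    using nontrivial by (intro continuous_attains_sup compact_K continuous_intros) auto
  then have "support_point u \<in> K \<and> (\<forall>z\<in>K. z \<bullet> u \<le> support_point u \<bullet> u)"
    unfolding support_point_def Bex_def by (rule someI_ex)
  then show "support_point u \<in> K" "z \<in> K \<Longrightarrow> z \<bullet> u \<le> support_point u \<bullet> u" by auto
qed

lemma support_point_frontier: "u \<noteq> 0 \<Longrightarrow> support_point u \<in> frontier K"
  using maximizer_in_frontier support_point_in support_point_max by blast

lemma antipodalD:
  assumes "x \<in> frontier K" "y \<in> frontier K" "norm \<sigma> = 1"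
  shows "(1 / 2) *\<^sub>R (x + y) + (norm (x - y) / 2) *\<^sub>R \<sigma> \<in> K \<or>
      (1 / 2) *\<^sub>R (x + y) - (norm (x - y) / 2) *\<^sub>R \<sigma> \<in> K"
  using antipodal assms unfolding antipodal_property_def by auto

definition width where "width u = norm (support_point u - support_point (- u))"

text \<open>
  The sphere over \<open>x = support_point u\<close> and \<open>y = support_point (- u)\<close> has its extreme points in direction
  \<open>u\<close> at the ends of the diameter parallel to \<open>u\<close>. One of these two lies in \<open>K\<close>, so it does not stick out
  of the supporting strip, which forces this diameter to be the one from \<open>y\<close> to \<open>x\<close>. So every
  chord joining opposite support points is normal to both support lines.
\<close>

lemma support_point_diff:
  assumes "norm u = 1"
  shows "support_point u - support_point (- u) = width u *\<^sub>R u"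
proof -
  define x y where "x = support_point u" and "y = support_point (- u)"
  have f: "x \<in> frontier K" "y \<in> frontier K"
    using assms support_point_frontier[of u] support_point_frontier[of "- u"] by (fastforce simp: x_def y_def)+
  have uu: "u \<bullet> u = 1" using assms by (simp add: dot_square_norm)
  have up: "z \<bullet> u \<le> x \<bullet> u" and lo: "y \<bullet> u \<le> z \<bullet> u" if "z \<in> K" for z
    using support_point_max[OF that, of u] support_point_max[OF that, of "- u"] by (auto simp: x_def y_def)
  have "norm (x - y) \<le> (x - y) \<bullet> u"
    using antipodalD[OF f assms]
  proof
    assume "(1 / 2) *\<^sub>R (x + y) + (norm (x - y) / 2) *\<^sub>R u \<in> K"
    from up[OF this] show ?thesis by (simp add: inner_add_left inner_diff_left uu field_simps)
  next
    assume "(1 / 2) *\<^sub>R (x + y) - (norm (x - y) / 2) *\<^sub>R u \<in> K"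
    from lo[OF this] show ?thesis by (simp add: inner_add_left inner_diff_left uu field_simps)
  qed
  then show ?thesis using scaleR_unit_if_inner_ge[OF assms] by (simp add: width_def x_def y_def)
qed

lemma width_le_diameter: "width u \<le> diameter K"
  using diameter_bounded_bound[OF compact_imp_bounded[OF compact_K] support_point_in support_point_in]
  by (simp add: width_def dist_norm)

lemma width_ge:
  assumes "norm u = 1" "norm v = 1"
  shows "width u * (u \<bullet> v) \<le> width v"
proof -
  have "width u * (u \<bullet> v) = (support_point u - support_point (- u)) \<bullet> v" using support_point_diff[OF assms(1)] by simp
  also have "\<dots> \<le> (support_point v - support_point (- v)) \<bullet> v"
    using support_point_max[OF support_point_in, of u v] support_point_max[OF support_point_in, of "- u" "- v"] by (simp add: inner_diff_left)
  also have "\<dots> = width v"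
    using support_point_diff[OF assms(2)] assms(2) by (simp add: dot_square_norm)
  finally show ?thesis .
qed

end

text \<open>
  Quantities that vary by at most a multiple of \<open>1 - cos\<close> of the angle vary quadratically. This is how
  derivatives are obtained although the boundary has no known regularity.
\<close>

lemma one_minus_cos_le: "1 - cos x \<le> x\<^sup>2 / 2" for x :: real
proof -
  have "\<bar>sin (x/2)\<bar> \<le> \<bar>x/2\<bar>" by (rule abs_sin_x_le_abs_x)
  then have "(sin (x/2))\<^sup>2 \<le> (x/2)\<^sup>2" by (rule abs_le_square_iff[THEN iffD1])
  moreover have "cos x = 1 - 2 * (sin (x/2))\<^sup>2" using cos_double_sin[of "x/2"] by simp
  ultimately show ?thesis by (simp add: power2_eq_square)
qed

lemma DERIV_zero_if_one_minus_cos: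
  fixes f :: "real \<Rightarrow> real"
  assumes "\<And>s. \<bar>f s - f t\<bar> \<le> C * (1 - cos (s - t))" "C \<ge> 0"
  shows "(f has_real_derivative 0) (at t)"
proof -
  have "((\<lambda>s. (f s - f t) / (s - t)) \<longlongrightarrow> 0) (at t)"
  proof (rule Lim_null_comparison)
    show "eventually (\<lambda>s. norm ((f s - f t) / (s - t)) \<le> C / 2 * \<bar>s - t\<bar>) (at t)"
    proof (rule always_eventually, rule allI)
      fix s
      have "\<bar>f s - f t\<bar> \<le> C * ((s - t)\<^sup>2 / 2)"
        using assms(1)[of s] mult_left_mono[OF one_minus_cos_le[of "s - t"] assms(2)] by linarith
      also have "\<dots> = (C / 2 * \<bar>s - t\<bar>) * \<bar>s - t\<bar>" by (simp add: power2_eq_square)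
      finally show "norm ((f s - f t) / (s - t)) \<le> C / 2 * \<bar>s - t\<bar>"
        using assms(2) by (cases "s = t") (auto simp: divide_le_eq)
    qed
    have "((\<lambda>s. C / 2 * \<bar>s - t\<bar>) \<longlongrightarrow> C / 2 * \<bar>t - t\<bar>) (at t)" by (intro tendsto_intros)
    then show "((\<lambda>s. C / 2 * \<bar>s - t\<bar>) \<longlongrightarrow> 0) (at t)" by simp
  qed
  then show ?thesis by (simp add: has_field_derivative_iff)
qed

context planar_body
begin

text \<open>
  The chord in direction \<open>cis a\<close> shows that the width in direction \<open>cis b\<close> is at least
  \<open>cos (a - b)\<close> times the width in direction \<open>cis a\<close>. So the width has derivative zero.
\<close>

lemma width_constant: "width (cis s) = width (cis t)"
proof -
  have le: "width (cis a) - width (cis b) \<le> diameter K * (1 - cos (a - b))" for a b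
  proof -
    have "width (cis a) * (1 - cos (a - b)) \<le> diameter K * (1 - cos (a - b))"
      using width_le_diameter by (intro mult_right_mono) auto
    then show ?thesis using width_ge[of "cis a" "cis b"] by (simp add: cis_inner_cis algebra_simps)
  qed
  have "\<bar>width (cis a) - width (cis b)\<bar> \<le> diameter K * (1 - cos (a - b))" for a b
    using le[of a b] le[of b a] cos_minus[of "a - b"] by (simp add: abs_le_iff)
  then have "((\<lambda>t. width (cis t)) has_real_derivative 0) (at t)" for t
    using diameter_ge_0[OF compact_imp_bounded[OF compact_K]]
    by (intro DERIV_zero_if_one_minus_cos[of _ _ "diameter K"]) auto
  then show ?thesis using DERIV_isconst_all[of "\<lambda>t. width (cis t)"] by blast
qed

section \<open>The curve of midpoints of the diametral chords\<close>

definition r where "r = width 1 / 2"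

definition m :: "real \<Rightarrow> complex" where "m t = (1 / 2) *\<^sub>R (support_point (cis t) + support_point (- cis t))"

lemma width_cis: "width (cis t) = 2 * r"
  using width_constant[of t 0] by (simp add: r_def)

lemma support_point_cis: "support_point (cis t) = m t + r *\<^sub>R cis t" "support_point (- cis t) = m t - r *\<^sub>R cis t"
proof -
  have *: "support_point (cis t) - support_point (- cis t) = (2 * r) *\<^sub>R cis t" using support_point_diff[of "cis t"] by (simp add: width_cis)
  have "m t + r *\<^sub>R cis t = (1/2) *\<^sub>R (support_point (cis t) + support_point (- cis t)) + (1/2) *\<^sub>R ((2 * r) *\<^sub>R cis t)"
    by (simp add: m_def)
  also have "\<dots> = support_point (cis t)" unfolding *[symmetric]
    by (simp add: scaleR_add_right scaleR_diff_right flip: scaleR_left_distrib)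
  finally show "support_point (cis t) = m t + r *\<^sub>R cis t" ..
  have "m t - r *\<^sub>R cis t = (1/2) *\<^sub>R (support_point (cis t) + support_point (- cis t)) - (1/2) *\<^sub>R ((2 * r) *\<^sub>R cis t)"
    by (simp add: m_def)
  also have "\<dots> = support_point (- cis t)" unfolding *[symmetric]
    by (simp add: scaleR_add_right scaleR_diff_right flip: scaleR_left_distrib)
  finally show "support_point (- cis t) = m t - r *\<^sub>R cis t" ..
qed

lemma r_nonneg: "r \<ge> 0" by (simp add: r_def width_def)

lemma m_periodic: "m (t + pi) = m t"
proof -
  have "cis (t + pi) = - cis t" by (simp add: complex_eq_iff)
  then show ?thesis by (simp add: m_def add.commute)
qed

lemma K_in_strip:
  assumes "z \<in> K"
  shows "\<bar>(z - m t) \<bullet> cis t\<bar> \<le> r"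
  using support_point_max[OF assms, of "cis t"] support_point_max[OF assms, of "- cis t"]
  by (simp add: support_point_cis inner_diff_left inner_add_left cis_inner_cis abs_le_iff)

lemma m_normal_variation: "\<bar>(m s - m t) \<bullet> cis t\<bar> \<le> r * (1 - cos (s - t))"
proof -
  have "\<bar>(support_point (cis s) - m t) \<bullet> cis t\<bar> \<le> r" "\<bar>(support_point (- cis s) - m t) \<bullet> cis t\<bar> \<le> r"
    by (auto intro: K_in_strip support_point_in)
  then show ?thesis
    unfolding support_point_cis abs_le_iff by (simp add: inner_diff_left inner_add_left cis_inner_cis algebra_simps)
qed

text \<open>
  The displacement \<open>m s - m t\<close> is quadratically small in the two directions \<open>cis s\<close> and \<open>cis t\<close>. These are
  nearly parallel, so in the orthogonal direction this leaves a bound of first order.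
\<close>

lemma isCont_m: "isCont m t"
proof -
  have bound: "norm (m s - m t) \<le> r * (1 - cos (s - t)) + 2 * r * \<bar>tan ((s - t) / 2)\<bar>"
    if "\<bar>s - t\<bar> < pi" for s
  proof -
    define \<delta> where "\<delta> = s - t"
    define v where "v = m s - m t"
    have "\<bar>v \<bullet> cis t\<bar> \<le> r * (1 - cos \<delta>)" using m_normal_variation[of s t] by (simp add: v_def \<delta>_def)
    moreover have "\<bar>v \<bullet> cis s\<bar> \<le> r * (1 - cos \<delta>)"
      using m_normal_variation[of t s] cos_minus[of \<delta>]
      by (simp add: v_def \<delta>_def inner_diff_left abs_minus_commute)
    moreover have "v \<bullet> cis s = cos \<delta> * (v \<bullet> cis t) + sin \<delta> * (v \<bullet> (\<i> * cis t))"
    proof -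
      have "cis s = cos \<delta> *\<^sub>R cis t + sin \<delta> *\<^sub>R (\<i> * cis t)"
        using cos_add[of \<delta> t] sin_add[of \<delta> t] by (simp add: complex_eq_iff \<delta>_def)
      then show ?thesis by (simp add: inner_add_right)
    qed
    moreover have "\<bar>cos \<delta> * (v \<bullet> cis t)\<bar> \<le> \<bar>v \<bullet> cis t\<bar>"
      by (simp add: abs_mult mult_left_le_one_le)
    ultimately have *: "\<bar>sin \<delta> * (v \<bullet> (\<i> * cis t))\<bar> \<le> 2 * r * (1 - cos \<delta>)"
      by linarith
    have "\<bar>v \<bullet> (\<i> * cis t)\<bar> \<le> 2 * r * \<bar>tan (\<delta> / 2)\<bar>"
    proof (cases "\<delta> = 0")
      case True
      then show ?thesis by (simp add: v_def \<delta>_def)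
    next
      case False
      then have sn: "sin (\<delta>/2) \<noteq> 0" "cos (\<delta>/2) > 0"
        using that sin_eq_0_pi[of "\<delta>/2"] cos_gt_zero_pi[of "\<delta>/2"] by (auto simp: \<delta>_def abs_less_iff)
      have "sin \<delta> = 2 * sin (\<delta>/2) * cos (\<delta>/2)" "1 - cos \<delta> = 2 * (sin (\<delta>/2))\<^sup>2"
        using sin_double[of "\<delta>/2"] cos_double_sin[of "\<delta>/2"] by auto
      then have "(2 * \<bar>sin (\<delta>/2)\<bar>) * (cos (\<delta>/2) * \<bar>v \<bullet> (\<i> * cis t)\<bar>)
          \<le> (2 * \<bar>sin (\<delta>/2)\<bar>) * (2 * r * \<bar>sin (\<delta>/2)\<bar>)"
        using * sn by (simp add: abs_mult power2_eq_square mult_ac)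
      then have "cos (\<delta>/2) * \<bar>v \<bullet> (\<i> * cis t)\<bar> \<le> 2 * r * \<bar>sin (\<delta>/2)\<bar>"
        using sn by (subst (asm) mult_le_cancel_left_pos) auto
      then show ?thesis using sn by (simp add: tan_def abs_divide pos_le_divide_eq mult_ac)
    qed
    moreover have "norm v \<le> \<bar>v \<bullet> cis t\<bar> + \<bar>v \<bullet> (\<i> * cis t)\<bar>"
      using cmod_power2_cis[of v t] sqrt_sum_squares_le_sum_abs[of "v \<bullet> cis t" "v \<bullet> (\<i> * cis t)"]
      by (simp add: real_sqrt_unique)
    ultimately show ?thesis
      using \<open>\<bar>v \<bullet> cis t\<bar> \<le> r * (1 - cos \<delta>)\<close> by (simp add: v_def \<delta>_def)
  qed
  have "((\<lambda>s. m s - m t) \<longlongrightarrow> 0) (at t)"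
  proof (rule Lim_null_comparison)
    have "eventually (\<lambda>s. s \<in> {t - pi<..<t + pi}) (at t)"
      by (intro eventually_at_in_open') auto
    then show "eventually (\<lambda>s. norm (m s - m t)
        \<le> r * (1 - cos (s - t)) + 2 * r * \<bar>tan ((s - t) / 2)\<bar>) (at t)"
      by eventually_elim (auto intro!: bound simp: abs_less_iff)
    have "((\<lambda>s. r * (1 - cos (s - t)) + 2 * r * \<bar>tan ((s - t) / 2)\<bar>)
        \<longlongrightarrow> r * (1 - cos (t - t)) + 2 * r * \<bar>tan ((t - t) / 2)\<bar>) (at t)"
      by (intro tendsto_intros) auto
    then show "((\<lambda>s. r * (1 - cos (s - t)) + 2 * r * \<bar>tan ((s - t) / 2)\<bar>) \<longlongrightarrow> 0) (at t)"
      by simp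
  qed
  then show ?thesis by (simp add: isCont_def LIM_zero_iff)
qed

lemma m_height_deriv:
  "((\<lambda>t. (m t - c) \<bullet> cis t) has_real_derivative (m t - c) \<bullet> (\<i> * cis t)) (at t)"
proof -
  have "((\<lambda>s. (m s - m t) \<bullet> cis s) has_real_derivative 0) (at t)"
  proof (rule DERIV_zero_if_one_minus_cos[OF _ r_nonneg])
    fix s
    show "\<bar>(m s - m t) \<bullet> cis s - (m t - m t) \<bullet> cis t\<bar> \<le> r * (1 - cos (s - t))"
      using m_normal_variation[of t s] cos_minus[of "s - t"]
      by (simp add: inner_diff_left abs_minus_commute)
  qed
  moreover have "((\<lambda>s. (m t - c) \<bullet> cis s) has_real_derivative (m t - c) \<bullet> (\<i> * cis t)) (at t)"
    unfolding inner_complex_def by (auto intro!: derivative_eq_intros)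
  ultimately have "((\<lambda>s. (m s - m t) \<bullet> cis s + (m t - c) \<bullet> cis s) has_real_derivative
      0 + (m t - c) \<bullet> (\<i> * cis t)) (at t)"
    by (rule DERIV_add)
  then show ?thesis by (simp add: inner_diff_left)
qed

text \<open>
  Apply the hypothesis to the diametral chord in direction \<open>cis \<theta>\<close>: the circle with radius \<open>r\<close> and centre
  \<open>m \<theta>\<close> has one of its points in direction \<open>\<plusminus> cis \<phi>\<close> in \<open>K\<close>. That point lies in the strip of width \<open>2 * r\<close> around
  \<open>m \<psi>\<close> for every \<open>\<psi>\<close>, so the height \<open>G \<psi>\<close> of \<open>m \<psi>\<close> over \<open>m \<theta>\<close> is bounded on one side by a function that vanishes to
  second order at \<open>\<phi>\<close>. If \<open>G \<phi> = 0\<close>, then the derivative of \<open>G\<close> vanishes at \<open>\<phi>\<close> too, and the two together give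
  both components of \<open>m \<phi> - m \<theta>\<close>.
\<close>

lemma m_tangent:
  assumes "(m \<phi> - m \<theta>) \<bullet> cis \<phi> = 0"
  shows "m \<phi> = m \<theta>"
proof -
  define G where "G \<psi> = (m \<psi> - m \<theta>) \<bullet> cis \<psi>" for \<psi>
  define g where "g = (m \<phi> - m \<theta>) \<bullet> (\<i> * cis \<phi>)"
  have dG: "(G has_real_derivative g) (at \<phi>)" unfolding G_def g_def by (rule m_height_deriv)
  have dc: "((\<lambda>\<psi>. r * (1 - cos (\<phi> - \<psi>))) has_real_derivative 0) (at \<phi>)"
    by (auto intro!: derivative_eq_intros)
  have n: "norm (support_point (cis \<theta>) - support_point (- cis \<theta>)) / 2 = r"
    using width_cis[of \<theta>] by (simp add: width_def)
  have "m \<theta> + r *\<^sub>R cis \<phi> \<in> K \<or> m \<theta> - r *\<^sub>R cis \<phi> \<in> K"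
    using antipodalD[of "support_point (cis \<theta>)" "support_point (- cis \<theta>)" "cis \<phi>"] support_point_frontier n
    by (simp add: m_def)
  then have "g = 0"
  proof
    assume in_K: "m \<theta> + r *\<^sub>R cis \<phi> \<in> K"
    have "G \<psi> + r * (1 - cos (\<phi> - \<psi>)) \<ge> 0" for \<psi>
      using K_in_strip[OF in_K, of \<psi>] 
      by (simp add: G_def inner_diff_left inner_add_left cis_inner_cis abs_le_iff algebra_simps)
    moreover have "G \<phi> = 0" using assms by (simp add: G_def)
    ultimately show ?thesis
      using DERIV_local_min[OF DERIV_add[OF dG dc], of 1] by simp
  next
    assume in_K: "m \<theta> - r *\<^sub>R cis \<phi> \<in> K"
    have "G \<psi> - r * (1 - cos (\<phi> - \<psi>)) \<le> 0" for \<psi>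
      using K_in_strip[OF in_K, of \<psi>] 
      by (simp add: G_def inner_diff_left inner_add_left cis_inner_cis abs_le_iff algebra_simps)
    moreover have "G \<phi> = 0" using assms by (simp add: G_def)
    ultimately show ?thesis
      using DERIV_local_max[OF DERIV_diff[OF dG dc], of 1] by simp
  qed
  then show ?thesis
    using assms complex_eq_0_iff_inner_cis[of "m \<phi> - m \<theta>" \<phi>] by (simp add: g_def)
qed

sublocale turning_curve m
  by unfold_locales (auto simp: m_periodic intro: m_height_deriv m_tangent
      continuous_at_imp_continuous_on isCont_m)

text \<open>
  Since the midpoint does not move, \<open>K\<close> contains the circle of radius \<open>r\<close> around it, and lies in the
  disc. An interior point \<open>z\<close> of the disc is a corner of a rectangle with horizontal and vertical sides
  whose two neighbouring corners \<open>p\<close> and \<open>q\<close> are on the circle. The fourth corner is outside the disc, because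
  the squared distances of opposite corners from the centre have the same sum. As
  \<open>z\<close> and the fourth corner are antipodal on the circle over \<open>p\<close> and \<open>q\<close>, the point \<open>z\<close> lies in \<open>K\<close>.
\<close>

theorem is_disc: "\<exists>c R. R > 0 \<and> K = cball c R"
proof -
  define c where "c = m 0"
  have mc: "m t = c" for t unfolding c_def by (rule m_constant)
  have sub: "K \<subseteq> cball c r"
  proof
    fix z assume "z \<in> K"
    obtain t where "z - c = norm (z - c) *\<^sub>R cis t"
      using rcis_cmod_Arg[of "z - c"] by (metis rcis_def scaleR_conv_of_real)
    then have "(z - c) \<bullet> cis t = norm (z - c)"
      by (metis cis_inner_cis cos_zero diff_self inner_scaleR_left mult.right_neutral)
    then show "z \<in> cball c r"
      using K_in_strip[OF \<open>z \<in> K\<close>, of t] by (simp add: mc dist_norm norm_minus_commute)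
  qed
  have circ: "z \<in> frontier K" if "norm (z - c) = r" for z
  proof -
    obtain t where "z - c = norm (z - c) *\<^sub>R cis t"
      using rcis_cmod_Arg[of "z - c"] by (metis rcis_def scaleR_conv_of_real)
    then have "z = support_point (cis t)" using that by (simp add: support_point_cis mc algebra_simps)
    then show ?thesis by (simp add: support_point_frontier)
  qed
  have "cball c r \<subseteq> K"
  proof
    fix z assume z: "z \<in> cball c r"
    show "z \<in> K"
    proof (cases "norm (z - c) = r")
      case True
      then show ?thesis 
        using circ compact_imp_closed[OF compact_K] frontier_subset_closed by blast
    next
      case False
      define x y where "x = Re (z - c)" and "y = Im (z - c)"
      have lt: "x\<^sup>2 + y\<^sup>2 < r\<^sup>2"
      proof -
        have "norm (z - c) < r" using z False by (simp add: dist_norm norm_minus_commute)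
        then show ?thesis unfolding x_def y_def cmod_power2[symmetric]
          by (intro power_strict_mono) auto
      qed
      define a b where "a = sqrt (r\<^sup>2 - y\<^sup>2)" and "b = sqrt (r\<^sup>2 - x\<^sup>2)"
      have ab: "a\<^sup>2 = r\<^sup>2 - y\<^sup>2" "b\<^sup>2 = r\<^sup>2 - x\<^sup>2"
        using lt zero_le_power2[of x] zero_le_power2[of y]
        unfolding a_def b_def by (subst real_sqrt_pow2; linarith)+
      define p q where "p = c + Complex a y" and "q = c + Complex x b"
      have "norm (p - c) = r" "norm (q - c) = r"
        using ab r_nonneg by (simp_all add: p_def q_def complex_norm)
      then have pq: "p \<in> frontier K" "q \<in> frontier K" by (auto intro: circ)
      have "p \<noteq> q"
      proof
        assume "p = q"
        then have "a = x" by (simp add: p_def q_def)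
        then show False using ab lt by simp
      qed
      define \<sigma> where "\<sigma> = (1 / norm (p - q)) *\<^sub>R (2 *\<^sub>R z - (p + q))"
      have zc: "z = c + Complex x y" by (simp add: x_def y_def complex_eq_iff)
      have eqn: "norm (2 *\<^sub>R z - (p + q)) = norm (p - q)"
        by (simp add: zc p_def q_def cmod_def power2_commute)
      have "norm \<sigma> = 1" using eqn \<open>p \<noteq> q\<close> by (simp add: \<sigma>_def)
      moreover have "(norm (p - q) / 2) *\<^sub>R \<sigma> = z - (1/2) *\<^sub>R (p + q)"
        using \<open>p \<noteq> q\<close> by (simp add: \<sigma>_def scaleR_diff_right)
      moreover have "(1/2) *\<^sub>R (p + q) - (z - (1/2) *\<^sub>R (p + q)) = p + q - z"
        by (simp add: complex_eq_iff)
      ultimately have "z \<in> K \<or> p + q - z \<in> K"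
        using antipodalD[OF pq, of \<sigma>] by simp
      moreover have "p + q - z \<notin> K"
      proof
        assume "p + q - z \<in> K"
        then have "norm (p + q - z - c) \<le> r" using sub by (auto simp: dist_norm norm_minus_commute)
        moreover have "p + q - z - c = Complex a b" 
          by (simp add: p_def q_def zc complex_eq_iff)
        ultimately have "sqrt (a\<^sup>2 + b\<^sup>2) \<le> r" by (simp add: complex_norm)
        then have "a\<^sup>2 + b\<^sup>2 \<le> r\<^sup>2" using sqrt_le_D by blast
        then show False using ab lt by simp
      qed
      ultimately show ?thesis by blast
    qed
  qed
  with sub have K: "K = cball c r" by blast
  have "r \<noteq> 0"
  proof
    assume "r = 0"
    then show False using nontrivial K by auto
  qed
  then show ?thesis using K r_nonneg by (intro exI[of _ c] exI[of _ r]) auto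
qed

end

section \<open>Sections by planes\<close>

lemma frontier_vimage_subset:
  fixes F :: "'a::topological_space \<Rightarrow> 'b::topological_space"
  assumes "continuous_on UNIV F"
  shows "frontier (F -` K) \<subseteq> F -` frontier K"
proof -
  have "F ` closure (F -` S) \<subseteq> closure S" for S
    using assms continuous_on_subset closure_subset
    by (intro image_closure_subset) blast+
  from this[of K] this[of "- K"] show ?thesis
    by (auto simp: frontier_closures simp flip: vimage_Compl)
qed

definition plane_map :: "'a::real_vector \<Rightarrow> 'a \<Rightarrow> 'a \<Rightarrow> complex \<Rightarrow> 'a" where
  "plane_map p e1 e2 z = p + Re z *\<^sub>R e1 + Im z *\<^sub>R e2"

lemma norm_orthonormal_combination:
  fixes e1 e2 :: "'a::real_inner"
  assumes "norm e1 = 1" "norm e2 = 1" "e1 \<bullet> e2 = 0"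
  shows "norm (Re z *\<^sub>R e1 + Im z *\<^sub>R e2) = cmod z"
proof -
  have "(norm (Re z *\<^sub>R e1 + Im z *\<^sub>R e2))\<^sup>2 = (Re z)\<^sup>2 + (Im z)\<^sup>2"
    using assms by (subst norm_add_Pythagorean) (simp_all add: orthogonal_def)
  then show ?thesis by (simp add: cmod_def real_sqrt_unique)
qed

lemma norm_plane_map_diff:
  fixes e1 e2 :: "'a::real_inner"
  assumes "norm e1 = 1" "norm e2 = 1" "e1 \<bullet> e2 = 0"
  shows "norm (plane_map p e1 e2 z - plane_map p e1 e2 w) = cmod (z - w)"
  using norm_orthonormal_combination[OF assms, of "z - w"]
  by (simp add: plane_map_def algebra_simps)

text \<open>
  The property passes to plane sections, since the boundary of a section relative to its plane
  consists of boundary points of \<open>K\<close>.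
\<close>

lemma planar_body_slice:
  fixes K :: "'a::euclidean_space set"
  assumes K: "compact K" "antipodal_property K"
    and e: "norm e1 = 1" "norm e2 = 1" "e1 \<bullet> e2 = 0"
    and ab: "a \<noteq> b" "plane_map p e1 e2 a \<in> K" "plane_map p e1 e2 b \<in> K"
  shows "planar_body (plane_map p e1 e2 -` K)"
proof
  let ?F = "plane_map p e1 e2"
  have cont: "continuous_on UNIV ?F" unfolding plane_map_def by (intro continuous_intros)
  have "closed (?F -` K)"
    using K(1) cont by (simp add: compact_imp_closed continuous_on_closed_vimage)
  moreover have "bounded (?F -` K)"
  proof -
    obtain B where B: "\<And>x. x \<in> K \<Longrightarrow> norm x \<le> B" using compact_imp_bounded[OF K(1)] bounded_iff by metis
    have "norm z \<le> B + norm (?F 0)" if "?F z \<in> K" for z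
      using norm_plane_map_diff[OF e, of p z 0] B[OF that] norm_triangle_ineq4[of "?F z" "?F 0"] by simp
    then show ?thesis unfolding bounded_iff by auto
  qed
  ultimately show "compact (?F -` K)" by (simp add: compact_eq_bounded_closed)
  show "\<exists>a\<in>?F -` K. \<exists>b\<in>?F -` K. a \<noteq> b" using ab by auto
  show "antipodal_property (?F -` K)"
    unfolding antipodal_property_def
  proof (intro ballI)
    fix x y \<sigma> assume xy: "x \<in> frontier (?F -` K)" "y \<in> frontier (?F -` K)" and \<sigma>: "\<sigma> \<in> sphere (0::complex) 1"
    have "?F x \<in> frontier K" "?F y \<in> frontier K" using xy frontier_vimage_subset[OF cont] by auto
    moreover have "Re \<sigma> *\<^sub>R e1 + Im \<sigma> *\<^sub>R e2 \<in> sphere 0 1"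
      using norm_orthonormal_combination[OF e, of \<sigma>] \<sigma> by simp
    ultimately have "(1/2) *\<^sub>R (?F x + ?F y) + (norm (?F x - ?F y) / 2) *\<^sub>R (Re \<sigma> *\<^sub>R e1 + Im \<sigma> *\<^sub>R e2) \<in> K \<or>
        (1/2) *\<^sub>R (?F x + ?F y) - (norm (?F x - ?F y) / 2) *\<^sub>R (Re \<sigma> *\<^sub>R e1 + Im \<sigma> *\<^sub>R e2) \<in> K"
      using K(2) unfolding antipodal_property_def by blast
    moreover have "(1/2) *\<^sub>R (?F x + ?F y) + s *\<^sub>R (Re \<sigma> *\<^sub>R e1 + Im \<sigma> *\<^sub>R e2)
        = ?F ((1/2) *\<^sub>R (x + y) + s *\<^sub>R \<sigma>)"
      "(1/2) *\<^sub>R (?F x + ?F y) - s *\<^sub>R (Re \<sigma> *\<^sub>R e1 + Im \<sigma> *\<^sub>R e2)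
        = ?F ((1/2) *\<^sub>R (x + y) - s *\<^sub>R \<sigma>)" for s
    proof -
      have "p = (1/2) *\<^sub>R p + (1/2) *\<^sub>R p" by (simp flip: scaleR_left_distrib)
      then show "(1/2) *\<^sub>R (?F x + ?F y) + s *\<^sub>R (Re \<sigma> *\<^sub>R e1 + Im \<sigma> *\<^sub>R e2)
        = ?F ((1/2) *\<^sub>R (x + y) + s *\<^sub>R \<sigma>)"
      "(1/2) *\<^sub>R (?F x + ?F y) - s *\<^sub>R (Re \<sigma> *\<^sub>R e1 + Im \<sigma> *\<^sub>R e2)
        = ?F ((1/2) *\<^sub>R (x + y) - s *\<^sub>R \<sigma>)"
        by (simp_all add: plane_map_def algebra_simps add_divide_distrib)
    qed
    ultimately show "(1/2) *\<^sub>R (x + y) + (norm (x - y) / 2) *\<^sub>R \<sigma> \<in> ?F -` K \<or>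
        (1/2) *\<^sub>R (x + y) - (norm (x - y) / 2) *\<^sub>R \<sigma> \<in> ?F -` K"
      by (simp only: norm_plane_map_diff[OF e] vimage_eq)
  qed
qed

lemma obtain_plane_through:
  fixes v e1 :: "'a::euclidean_space"
  assumes "DIM('a) \<ge> 2" "norm e1 = 1"
  obtains e2 z where "norm e2 = 1" "e1 \<bullet> e2 = 0" "v = Re z *\<^sub>R e1 + Im z *\<^sub>R e2"
proof (cases "v = (v \<bullet> e1) *\<^sub>R e1")
  case True
  obtain y where y: "y \<noteq> 0" "orthogonal e1 y" using orthogonal_to_vector_exists[OF assms(1)] .
  show ?thesis
    using y True by (intro that[of "y /\<^sub>R norm y" "of_real (v \<bullet> e1)"]) (auto simp: orthogonal_def)
next
  case False
  define w where "w = v - (v \<bullet> e1) *\<^sub>R e1"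
  have "w \<noteq> 0" using False by (simp add: w_def)
  moreover have "e1 \<bullet> w = 0"
    using assms(2) by (simp add: w_def inner_diff_right dot_square_norm inner_commute)
  ultimately show ?thesis
    by (intro that[of "w /\<^sub>R norm w" "Complex (v \<bullet> e1) (norm w)"]) (auto simp: w_def)
qed

text \<open>
  A disc with two points at distance \<open>2 * s\<close> and diameter at most \<open>2 * s\<close> has these points as the ends of a
  diameter; the parallelogram law gives the centre.
\<close>

lemma disc_through_diameter:
  fixes c :: complex
  assumes "of_real s \<in> cball c R" "of_real (- s) \<in> cball c R" "R \<le> s"
  shows "cball c R = cball 0 s"
proof -
  have "(cmod (of_real s - c))\<^sup>2 + (cmod (of_real (- s) - c))\<^sup>2 = 2 * s\<^sup>2 + 2 * (cmod c)\<^sup>2"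
    unfolding cmod_power2 by (simp add: power2_eq_square algebra_simps)
  moreover have "(cmod (of_real s - c))\<^sup>2 \<le> R\<^sup>2" "(cmod (of_real (- s) - c))\<^sup>2 \<le> R\<^sup>2"
    using assms by (auto intro!: power_mono simp: dist_norm norm_minus_commute)
  moreover have "0 \<le> R" using assms(1) by (metis cball_eq_empty empty_iff not_le)
  moreover have "R\<^sup>2 \<le> s\<^sup>2" using assms(3) \<open>0 \<le> R\<close> by (intro power_mono)
  ultimately have "(cmod c)\<^sup>2 \<le> 0" by linarith
  then have "c = 0" by simp
  then show ?thesis using assms by auto
qed

text \<open>
  Fix two points of \<open>K\<close> at maximal distance. Every plane through both meets \<open>K\<close> in a disc whose
  diameter is exactly their distance, hence in the disc with these two points as antipodes. These
  planes cover the space, so \<open>K\<close> is the ball over the two points.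
\<close>

theorem antipodal_property_imp_ball:
  fixes K :: "'a::euclidean_space set"
  assumes dim: "DIM('a) \<ge> 2" and K: "compact K" "antipodal_property K"
    and two: "\<exists>a\<in>K. \<exists>b\<in>K. a \<noteq> b"
  shows "\<exists>p s. s > 0 \<and> K = cball p s"
proof -
  obtain x y where xy: "x \<in> K" "y \<in> K" "dist x y = diameter K"
    using diameter_compact_attained[OF K(1)] two by blast
  have far: "dist u v \<le> dist x y" if "u \<in> K" "v \<in> K" for u v
    using diameter_bounded_bound[OF compact_imp_bounded[OF K(1)] that] xy(3) by simp
  have "x \<noteq> y"
  proof
    assume "x = y"
    then have "u = v" if "u \<in> K" "v \<in> K" for u v using far[OF that] by simp
    then show False using two by blast
  qed
  define p s e1 where "p = (1/2) *\<^sub>R (x + y)" and "s = norm (x - y) / 2"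
    and "e1 = (x - y) /\<^sub>R norm (x - y)"
  have s: "s > 0" and e1: "norm e1 = 1" using \<open>x \<noteq> y\<close> by (auto simp: s_def e1_def)
  have "s *\<^sub>R e1 = (1/2) *\<^sub>R (x - y)" using \<open>x \<noteq> y\<close> by (simp add: s_def e1_def)
  then have ends: "p + s *\<^sub>R e1 = x" "p - s *\<^sub>R e1 = y"
    by (simp_all add: p_def scaleR_add_right scaleR_diff_right flip: scaleR_left_distrib)
  have "u \<in> K \<longleftrightarrow> u \<in> cball p s" for u
  proof -
    obtain e2 z where e2: "norm e2 = 1" "e1 \<bullet> e2 = 0" and z: "u - p = Re z *\<^sub>R e1 + Im z *\<^sub>R e2"
      using obtain_plane_through[OF dim e1] .
    let ?F = "plane_map p e1 e2"
    have F: "?F (of_real s) = x" "?F (of_real (- s)) = y" using ends by (auto simp: plane_map_def)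
    have "(of_real s :: complex) \<noteq> of_real (- s)" using s by (simp del: of_real_minus)
    then interpret planar_body "?F -` K"
      using planar_body_slice[OF K e1 e2] F xy by metis
    obtain c R where cR: "R > 0" "?F -` K = cball c R" using is_disc by blast
    have "c + of_real R \<in> cball c R" "c - of_real R \<in> cball c R" using cR(1) by (auto simp: dist_norm)
    then have "dist (?F (c + of_real R)) (?F (c - of_real R)) \<le> dist x y"
      by (intro far) (simp_all flip: cR(2))
    then have "cmod (2 * of_real R) \<le> 2 * s"
      by (simp add: dist_norm norm_plane_map_diff[OF e1 e2] s_def)
    then have "R \<le> s" using cR(1) by (simp add: norm_mult)
    moreover have "of_real s \<in> ?F -` K" "of_real (- s) \<in> ?F -` K" using F xy by auto
    ultimately have "?F -` K = cball 0 s" using disc_through_diameter cR(2) by metis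
    moreover have "?F z = u" using z by (simp add: plane_map_def algebra_simps)
    moreover have "norm (u - p) = cmod z" using z norm_orthonormal_combination[OF e1 e2] by simp
    ultimately show ?thesis
      by (metis dist_0_norm dist_norm mem_cball norm_minus_commute vimage_eq)
  qed
  then show ?thesis using s by blast
qed

theorem theorem4p1:
  fixes K :: "(real ^ 'n) set"
  assumes "CARD('n) \<ge> 2"
    and "compact K"
    and "\<exists>a\<in>K. \<exists>b\<in>K. a \<noteq> b"
    and "\<And>x y \<sigma>. x \<in> frontier K \<Longrightarrow> y \<in> frontier K \<Longrightarrow> \<sigma> \<in> sphere 0 1 \<Longrightarrow>
           (1 / 2) *\<^sub>R (x + y) + (norm (x - y) / 2) *\<^sub>R \<sigma> \<in> K \<or>
           (1 / 2) *\<^sub>R (x + y) - (norm (x - y) / 2) *\<^sub>R \<sigma> \<in> K"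
  shows "\<exists>x0 R. R > 0 \<and> K = {y. norm (y - x0) \<le> R}"
proof -
  have "antipodal_property K" using assms(4) unfolding antipodal_property_def by blast
  moreover have "DIM(real ^ 'n) \<ge> 2" using assms(1) by simp
  ultimately obtain p s where "s > 0" "K = cball p s"
    using antipodal_property_imp_ball assms(2,3) by blast
  then show ?thesis
    by (intro exI[of _ p] exI[of _ s]) (auto simp: dist_norm norm_minus_commute)
qed

end
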